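(* Let $\mathbb T^2$ be the smooth, compact, oriented two-dimensional torus and let $\mathbb S^3\subset\mathbb R^4$ be the unit three-sphere with the metric induced by the canonical inner product of $\mathbb R^4$. For every $r\geq 3$ there exist embeddings $\alpha:\mathbb T^2\to\mathbb S^3$ of class $C^r$ such that all leaves of both asymptotic foliations $\mathcal A_{\alpha,1}$ and $\mathcal A_{\alpha,2}$ of $\alpha$ are dense in $\mathbb T^2$.
   Context: Let $\mathbb M$ be a smooth, compact, oriented two-dimensional manifold and $\alpha:\mathbb M\to\mathbb S^3$ an immersion of class $C^r$, $r\ge 3$, where $\mathbb S^3\subset\mathbb R^4$ carries the metric induced by the canonical inner product $\langle\cdot,\cdot\rangle$ of $\mathbb R^4$. Let $N_\alpha$ be the positive unit normal of $\alpha$: the unit vector field along $\alpha$, tangent to $\mathbb S^3$ (i.e. $\langle N_\alpha,\alpha\rangle=0$), normal to the immersed surface, with direction fixed by the orientations (in a positive chart $(u,v)$ it is the normalization of $\alpha\wedge\alpha_u\wedge\alpha_v$). The second fundamental form is $$II_\alpha(p;v,w)=\langle -DN_\alpha(p;v),D\alpha(p;w)\rangle,\qquad v,w\in T_p\mathbb M.$$ The extrinsic Gaussian curvature is $\mathcal K_{ext}=\det(DN_\alpha)$ (the determinant of the shape operator), and the hyperbolic region is $\mathbb H_\alpha=\{p\in\mathbb M:\mathcal K_{ext}(p)<0\}$. At each $p\in\mathbb H_\alpha$ there are exactly two asymptotic directions, namely the two transverse lines in $T_p\mathbb M$ on which $II_\alpha(p;v,v)=0$; locally $II_\alpha$ splits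 as a product of two one-forms $\omega_{\alpha,1},\omega_{\alpha,2}$ whose kernels are these directions. Since $\mathbb M$ is oriented, these directions can be globally and consistently ordered on all of $\mathbb H_\alpha$, giving two line fields $\mathcal L_{\alpha,1},\mathcal L_{\alpha,2}$ of class $C^{r-2}$ on $\mathbb H_\alpha$ (which one is called first is immaterial for the claim). The asymptotic foliations $\mathcal A_{\alpha,1},\mathcal A_{\alpha,2}$ are the integral foliations of $\mathcal L_{\alpha,1},\mathcal L_{\alpha,2}$; they fill out $\mathbb H_\alpha$, and their leaves are the asymptotic lines. An asymptotic line (leaf) $\gamma$ is called dense if $L(\gamma)=\mathbb M$, where $L(\gamma)$, the limit set of $\gamma$, is the union of its $\alpha$-limit set and its $\omega$-limit set. (Here "$\alpha$-limit set" is the usual dynamical notion, unrelated to the immersion $\alpha$.) *)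

theory Defs
  imports "HOL-Analysis.Analysis"
begin

text \<open>
  The torus is the product of two unit circles. Its smooth structure and orientation are those
  for which \<open>torus_cover\<close> is an orientation preserving local diffeomorphism: positive charts are the
  local inverses of \<open>torus_cover\<close>. A map \<open>\<alpha>\<close> on the torus is therefore studied through
  \<open>\<alpha> \<circ> torus_cover\<close>, and the tangent space at \<open>torus_cover x\<close> is identified with the plane by the
  derivative of \<open>torus_cover\<close> at \<open>x\<close>.
\<close>

definition torus :: "(complex \<times> complex) set" where
  "torus = sphere 0 1 \<times> sphere 0 1"

definition torus_cover :: "real^2 \<Rightarrow> complex \<times> complex" where
  "torus_cover x = (cis (x $ 1), cis (x $ 2))"

fun C_k :: "nat \<Rightarrow> ('a::euclidean_space \<Rightarrow> 'b::real_normed_vector) \<Rightarrow> bool" where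
  "C_k 0 f \<longleftrightarrow> continuous_on UNIV f"
| "C_k (Suc k) f \<longleftrightarrow> (\<forall>x. f differentiable (at x)) \<and>
     (\<forall>v. C_k k (\<lambda>x. frechet_derivative f (at x) v))"

definition torus_immersion :: "nat \<Rightarrow> (complex \<times> complex \<Rightarrow> real^4) \<Rightarrow> bool" where
  "torus_immersion r \<alpha> \<longleftrightarrow> \<alpha> \<in> torus \<rightarrow> sphere 0 1 \<and> C_k r (\<alpha> \<circ> torus_cover) \<and>
     (\<forall>x. inj (frechet_derivative (\<alpha> \<circ> torus_cover) (at x)))"

definition torus_embedding :: "nat \<Rightarrow> (complex \<times> complex \<Rightarrow> real^4) \<Rightarrow> bool" where
  "torus_embedding r \<alpha> \<longleftrightarrow> torus_immersion r \<alpha> \<and>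
     embedding_map (top_of_set torus) (top_of_set (sphere 0 1)) \<alpha>"


text \<open>
  Geometry of a parametrized surface \<open>f\<close> in the unit three-sphere. The vector
  \<open>wedge3 a b c\<close> is the one whose inner product with \<open>d\<close> is the determinant of \<open>a, b, c, d\<close>.
\<close>

definition wedge3 :: "real^4 \<Rightarrow> real^4 \<Rightarrow> real^4 \<Rightarrow> real^4" where
  "wedge3 a b c = (\<chi> i. det (vector [a, b, c, axis i 1] :: real^4^4))"

definition unit_normal :: "(real^2 \<Rightarrow> real^4) \<Rightarrow> real^2 \<Rightarrow> real^4" where
  "unit_normal f x = sgn (wedge3 (f x) (frechet_derivative f (at x) (axis 1 1))
                                       (frechet_derivative f (at x) (axis 2 1)))"

definition second_fundamental_form ::
    "(real^2 \<Rightarrow> real^4) \<Rightarrow> real^2 \<Rightarrow> real^2 \<Rightarrow> real^2 \<Rightarrow> real" where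
  "second_fundamental_form f x v w =
     (- frechet_derivative (unit_normal f) (at x) v) \<bullet> frechet_derivative f (at x) w"

text \<open>
  The derivative of the unit normal takes values in the image of the derivative of \<open>f\<close>; pulled
  back along the latter it is an endomorphism of the tangent space (minus the shape operator, which
  has the same determinant in dimension two).
\<close>

definition normal_endomorphism :: "(real^2 \<Rightarrow> real^4) \<Rightarrow> real^2 \<Rightarrow> real^2 \<Rightarrow> real^2" where
  "normal_endomorphism f x v =
     (THE w. frechet_derivative f (at x) w = frechet_derivative (unit_normal f) (at x) v)"

definition K_ext :: "(real^2 \<Rightarrow> real^4) \<Rightarrow> real^2 \<Rightarrow> real" where
  "K_ext f x = det (matrix (normal_endomorphism f x))"

definition hyperbolic_region :: "(complex \<times> complex \<Rightarrow> real^4) \<Rightarrow> (complex \<times> complex) set" where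
  "hyperbolic_region \<alpha> = torus_cover ` {x. K_ext (\<alpha> \<circ> torus_cover) x < 0}"

text \<open>
  Where \<open>K_ext\<close> is negative, let \<open>v\<close> and \<open>v'\<close> span the two asymptotic lines. The sign of
  \<open>det (v, v') * II (v, v')\<close> does not change if \<open>v\<close> or \<open>v'\<close> is rescaled, and is reversed if \<open>v\<close> and
  \<open>v'\<close> are exchanged. The first line is the one whose vectors \<open>v\<close> give the positive sign. This
  ordering depends only on \<open>II\<close> and on the orientation of the tangent space, hence is consistent on
  the whole hyperbolic region.
\<close>

definition asymptotic_line_field1 :: "(real^2 \<Rightarrow> real^4) \<Rightarrow> real^2 \<Rightarrow> (real^2) set" where
  "asymptotic_line_field1 f x = {v. second_fundamental_form f x v v = 0 \<and>
     (v = 0 \<or> (\<exists>v'. second_fundamental_form f x v' v' = 0 \<and>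
        det (vector [v, v'] :: real^2^2) * second_fundamental_form f x v v' > 0))}"

definition asymptotic_line_field2 :: "(real^2 \<Rightarrow> real^4) \<Rightarrow> real^2 \<Rightarrow> (real^2) set" where
  "asymptotic_line_field2 f x = {v. second_fundamental_form f x v v = 0 \<and>
     (v = 0 \<or> (\<exists>v'. second_fundamental_form f x v' v' = 0 \<and>
        det (vector [v, v'] :: real^2^2) * second_fundamental_form f x v v' < 0))}"

text \<open>
  Integral curves are parametrized by arc length on an open interval \<open>I\<close>, so that a leaf
  is an integral curve that cannot be extended to a larger interval. This includes closed leaves,
  which are traversed infinitely often in both directions. Curves on the torus are given by their lifts
  \<open>c\<close> to the plane, where \<open>L\<close> is a field of lines.
\<close>

definition integral_curve ::
    "(complex \<times> complex \<Rightarrow> real^4) \<Rightarrow> (real^2 \<Rightarrow> (real^2) set) \<Rightarrow> real set \<Rightarrow> (real \<Rightarrow> real^2) \<Rightarrow> bool"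
  where
  "integral_curve \<alpha> L I c \<longleftrightarrow> open I \<and> is_interval I \<and> I \<noteq> {} \<and>
     (\<forall>t\<in>I. torus_cover (c t) \<in> hyperbolic_region \<alpha>) \<and>
     (\<exists>c'. continuous_on I c' \<and>
       (\<forall>t\<in>I. (c has_vector_derivative c' t) (at t) \<and> c' t \<in> L (c t) \<and>
              norm (frechet_derivative (\<alpha> \<circ> torus_cover) (at (c t)) (c' t)) = 1))"

definition maximal_integral_curve ::
    "(complex \<times> complex \<Rightarrow> real^4) \<Rightarrow> (real^2 \<Rightarrow> (real^2) set) \<Rightarrow> real set \<Rightarrow> (real \<Rightarrow> real^2) \<Rightarrow> bool"
  where
  "maximal_integral_curve \<alpha> L I c \<longleftrightarrow> integral_curve \<alpha> L I c \<and>
     (\<forall>J d. integral_curve \<alpha> L J d \<and> I \<subseteq> J \<and> (\<forall>t\<in>I. d t = c t) \<longrightarrow> J = I)"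

definition integral_foliation ::
    "(complex \<times> complex \<Rightarrow> real^4) \<Rightarrow> (real^2 \<Rightarrow> (real^2) set) \<Rightarrow>
     (real set \<times> (real \<Rightarrow> complex \<times> complex)) set" where
  "integral_foliation \<alpha> L = {(I, torus_cover \<circ> c) | I c. maximal_integral_curve \<alpha> L I c}"

definition asymptotic_foliation1 ::
    "(complex \<times> complex \<Rightarrow> real^4) \<Rightarrow> (real set \<times> (real \<Rightarrow> complex \<times> complex)) set" where
  "asymptotic_foliation1 \<alpha> = integral_foliation \<alpha> (asymptotic_line_field1 (\<alpha> \<circ> torus_cover))"

definition asymptotic_foliation2 ::
    "(complex \<times> complex \<Rightarrow> real^4) \<Rightarrow> (real set \<times> (real \<Rightarrow> complex \<times> complex)) set" where
  "asymptotic_foliation2 \<alpha> = integral_foliation \<alpha> (asymptotic_line_field2 (\<alpha> \<circ> torus_cover))"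

definition omega_limit_set :: "real set \<Rightarrow> (real \<Rightarrow> 'a::topological_space) \<Rightarrow> 'a set" where
  "omega_limit_set I \<gamma> = {p. \<exists>s::nat \<Rightarrow> real. (\<forall>n. s n \<in> I) \<and>
     (\<forall>t\<in>I. \<forall>\<^sub>F n in sequentially. t < s n) \<and> (\<lambda>n. \<gamma> (s n)) \<longlonglongrightarrow> p}"

definition alpha_limit_set :: "real set \<Rightarrow> (real \<Rightarrow> 'a::topological_space) \<Rightarrow> 'a set" where
  "alpha_limit_set I \<gamma> = {p. \<exists>s::nat \<Rightarrow> real. (\<forall>n. s n \<in> I) \<and>
     (\<forall>t\<in>I. \<forall>\<^sub>F n in sequentially. s n < t) \<and> (\<lambda>n. \<gamma> (s n)) \<longlonglongrightarrow> p}"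

definition dense_leaf :: "real set \<times> (real \<Rightarrow> complex \<times> complex) \<Rightarrow> bool" where
  "dense_leaf = (\<lambda>(I, \<gamma>). alpha_limit_set I \<gamma> \<union> omega_limit_set I \<gamma> = torus)"

end

theory Submission
  imports Defs "HOL-Analysis.Kronecker_Approximation_Theorem"
begin

text \<open>
  The example is a torus of revolution. For a positive function \<open>w\<close> of period \<open>2 \<pi>\<close>, the map
  \<open>F (u, v) = (w v cis u, cis v)\<close> into complex 2-space, divided by its norm, embeds the torus in
  the three-sphere. The reflections that fix a meridian \<open>u = const\<close> make \<open>u\<close> and \<open>v\<close>
  coordinates of lines of curvature, and the second fundamental form is a nonvanishing multiple of
  \<open>w du\<^sup>2 - (w + w'') dv\<^sup>2\<close>. If \<open>w + w'' > 0\<close> the whole torus is therefore hyperbolic, and its asymptotic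
  lines are the solutions of \<open>du/dv = \<plusminus> sqrt ((w + w'') / w)\<close>. The right hand side does not involve
  \<open>u\<close>, so the first return map of each foliation to a circle \<open>v = const\<close> is a rigid rotation, by \<open>2 \<pi> \<rho>\<close>
  or \<open>- 2 \<pi> \<rho>\<close>, where \<open>2 \<pi> \<rho>\<close> is the integral of the square root over a period. If \<open>\<rho>\<close> is irrational, all
  orbits of both rotations are dense, and so are all leaves.
  
  The Clifford torus is the case \<open>w = 1\<close>, where \<open>\<rho> = 1\<close> and all asymptotic lines are closed. The choice
  \<open>w v = 1 + e cos v\<close> has \<open>w + w'' = 1\<close>, so \<open>2 \<pi> \<rho> (e)\<close> is the integral of \<open>1 / sqrt (1 + e cos v)\<close>. By strict
  convexity \<open>\<rho> (1/2) > 1 = \<rho> (0)\<close>, and \<open>\<rho>\<close> is continuous in \<open>e\<close>, so it takes an irrational value. These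
  tori are of class \<open>C\<^sup>k\<close> for every \<open>k\<close>, so one torus serves all \<open>r\<close>.
  
  The geometry is in \<open>second_fundamental_form_f\<close>, \<open>K_ext_neg\<close> and \<open>torus_embedding_\<alpha>\<close>, the dynamics in
  \<open>maximal_integral_curve_form\<close>, which shows that maximal leaves are complete, and in
  \<open>maximal_integral_curve_dense\<close>; the choice of \<open>e\<close> is \<open>exists_irrational_rotation_number\<close>.
\<close>

section \<open>Vectors and determinants in dimension four\<close>

lemma det_4:
  "det (A::'a::comm_ring_1^4^4) =
    A$1$1 * (A$2$2 * (A$3$3 * A$4$4 - A$3$4 * A$4$3) - A$2$3 * (A$3$2 * A$4$4 - A$3$4 * A$4$2)
             + A$2$4 * (A$3$2 * A$4$3 - A$3$3 * A$4$2))
  - A$1$2 * (A$2$1 * (A$3$3 * A$4$4 - A$3$4 * A$4$3) - A$2$3 * (A$3$1 * A$4$4 - A$3$4 * A$4$1)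
             + A$2$4 * (A$3$1 * A$4$3 - A$3$3 * A$4$1))
  + A$1$3 * (A$2$1 * (A$3$2 * A$4$4 - A$3$4 * A$4$2) - A$2$2 * (A$3$1 * A$4$4 - A$3$4 * A$4$1)
             + A$2$4 * (A$3$1 * A$4$2 - A$3$2 * A$4$1))
  - A$1$4 * (A$2$1 * (A$3$2 * A$4$3 - A$3$3 * A$4$2) - A$2$2 * (A$3$1 * A$4$3 - A$3$3 * A$4$1)
             + A$2$3 * (A$3$1 * A$4$2 - A$3$2 * A$4$1))"
proof -
  have f: "finite {2::4, 3, 4}" "1 \<notin> {2::4, 3, 4}" "finite {3::4, 4}" "2 \<notin> {3::4, 4}"
    "finite {4::4}" "3 \<notin> {4::4}"
    by auto
  show ?thesis
    unfolding det_def UNIV_4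
    unfolding sum_over_permutations_insert[OF f(1,2)]
    unfolding sum_over_permutations_insert[OF f(3,4)]
    unfolding sum_over_permutations_insert[OF f(5,6)]
    unfolding permutes_sing
    by (simp add: sign_swap_id permutation_swap_id permutation_compose sign_compose sign_id swap_id_eq algebra_simps)
qed

lemma vector_4 [simp]:
  "(vector [a, b, c, d] :: 'a::zero^4) $ 1 = a" "(vector [a, b, c, d] :: 'a::zero^4) $ 2 = b"
  "(vector [a, b, c, d] :: 'a::zero^4) $ 3 = c" "(vector [a, b, c, d] :: 'a::zero^4) $ 4 = d"
  unfolding vector_def by simp_all

lemma vector_4_eqI:
  fixes x y :: "'a^4"
  assumes "x $ 1 = y $ 1" "x $ 2 = y $ 2" "x $ 3 = y $ 3" "x $ 4 = y $ 4"
  shows "x = y"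
  using assms by (simp add: vec_eq_iff forall_4)

lemma inner_4: "(x::real^4) \<bullet> y = x $ 1 * y $ 1 + x $ 2 * y $ 2 + x $ 3 * y $ 3 + x $ 4 * y $ 4"
  by (simp add: inner_vec_def sum_4)

lemma axis_4: "axis (i::4) (1::real) = vector [of_bool (i = 1), of_bool (i = 2), of_bool (i = 3), of_bool (i = 4)]"
  by (rule vector_4_eqI) (auto simp: axis_def)

lemma continuous_on_vector_4:
  fixes X :: "'a::t2_space set"
  assumes "continuous_on X a" "continuous_on X b" "continuous_on X c" "continuous_on X d"
  shows "continuous_on X (\<lambda>x. vector [a x, b x, c x, d x] :: real^4)"
proof -
  have "continuous_on X (\<lambda>x. (vector [a x, b x, c x, d x] :: real^4) $ i)" for i
    using exhaust_4[of i] assms by auto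
  then show ?thesis
    by (subst continuous_on_componentwise) (auto simp: Basis_vec_def inner_axis)
qed

lemma wedge3_nth:
  "wedge3 a b c $ 1 = - (a $ 2 * (b $ 3 * c $ 4 - b $ 4 * c $ 3) - a $ 3 * (b $ 2 * c $ 4 - b $ 4 * c $ 2)
      + a $ 4 * (b $ 2 * c $ 3 - b $ 3 * c $ 2))"
  "wedge3 a b c $ 2 = a $ 1 * (b $ 3 * c $ 4 - b $ 4 * c $ 3) - a $ 3 * (b $ 1 * c $ 4 - b $ 4 * c $ 1)
      + a $ 4 * (b $ 1 * c $ 3 - b $ 3 * c $ 1)"
  "wedge3 a b c $ 3 = - (a $ 1 * (b $ 2 * c $ 4 - b $ 4 * c $ 2) - a $ 2 * (b $ 1 * c $ 4 - b $ 4 * c $ 1)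
      + a $ 4 * (b $ 1 * c $ 2 - b $ 2 * c $ 1))"
  "wedge3 a b c $ 4 = a $ 1 * (b $ 2 * c $ 3 - b $ 3 * c $ 2) - a $ 2 * (b $ 1 * c $ 3 - b $ 3 * c $ 1)
      + a $ 3 * (b $ 1 * c $ 2 - b $ 2 * c $ 1)"
  by (simp_all add: wedge3_def det_4 axis_4, simp_all add: algebra_simps)

lemma wedge3_scaleR: "wedge3 (a *\<^sub>R x) (b *\<^sub>R y) (c *\<^sub>R z) = (a * b * c) *\<^sub>R wedge3 x y z"
  by (rule vector_4_eqI) (simp_all add: wedge3_nth algebra_simps)

section \<open>Derivatives and smoothness\<close>

lemma DERIV_inverse_sqrt:
  assumes "(h has_real_derivative h') (at t)" "h t > 0"
  shows "((\<lambda>t. 1 / sqrt (h t)) has_real_derivative - (h' / 2) * (1 / sqrt (h t)) ^ 3) (at t)"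
proof -
  have "((\<lambda>t. inverse (sqrt (h t))) has_real_derivative
      - (inverse (sqrt (h t)) * (inverse (sqrt (h t)) / 2 * h') * inverse (sqrt (h t)))) (at t)"
    using assms by (intro DERIV_inverse' DERIV_chain2[OF DERIV_real_sqrt]) auto
  then show ?thesis
    by (simp add: inverse_eq_divide power3_eq_cube mult_ac del: real_sqrt_mult_self)
qed

lemma has_derivative_coordinates:
  fixes F :: "real^2 \<Rightarrow> real^'n"
  assumes "\<And>i. ((\<lambda>x. F x $ i) has_derivative (\<lambda>a. a $ 1 * A $ i + a $ 2 * B $ i)) (at x)"
  shows "(F has_derivative (\<lambda>a. a $ 1 *\<^sub>R A + a $ 2 *\<^sub>R B)) (at x)"
  using assms by (subst has_derivative_componentwise_within) (auto simp: Basis_vec_def inner_axis)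

lemma has_derivative_of_coordinate:
  assumes "(h has_real_derivative h') (at (x $ i))"
  shows "((\<lambda>x::real^'n. h (x $ i)) has_derivative (\<lambda>a. a $ i * h')) (at x)"
proof -
  have "((\<lambda>x::real^'n. x $ i) has_derivative (\<lambda>a. a $ i)) (at x)"
    by (rule bounded_linear_imp_has_derivative[OF bounded_linear_vec_nth])
  from has_derivative_compose[OF this assms[unfolded has_field_derivative_def]]
  show ?thesis by (simp add: mult.commute)
qed

text \<open>
  Smoothness of an explicit map follows at all orders at once if it belongs to a class of maps that
  contains the directional derivatives of its members; no derivative of order above one is computed.
\<close>

lemma C_k_if_closed_under_derivatives:
  assumes "f \<in> A"
    and "\<And>f. f \<in> A \<Longrightarrow> \<exists>f'. (\<forall>x. (f has_derivative f' x) (at x)) \<and> (\<forall>v. (\<lambda>x. f' x v) \<in> A)"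
  shows "C_k k f"
  using assms(1)
proof (induction k arbitrary: f)
  case 0
  then obtain f' where "\<And>x. (f has_derivative f' x) (at x)" using assms(2) by blast
  then show ?case
    by (auto intro!: continuous_at_imp_continuous_on has_derivative_continuous)
next
  case (Suc k)
  then obtain f' where f': "\<And>x. (f has_derivative f' x) (at x)" "\<And>v. (\<lambda>x. f' x v) \<in> A"
    using assms(2) by blast
  have "frechet_derivative f (at x) = f' x" for x
    using frechet_derivative_at[OF f'(1)[of x]] by simp
  then show ?case
    using Suc.IH[OF f'(2)] f'(1) by (auto simp: differentiable_def)
qed

section \<open>Asymptotic lines of a diagonal second fundamental form\<close>

text \<open>
  The form vanishes on the lines spanned by \<open>(g, 1)\<close> and \<open>(- g, 1)\<close> with \<open>g = 1 / sqrt w\<close>.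
  Pairing these two vectors gives determinant \<open>2 g\<close> and value \<open>- 2 \<kappa>\<close> of the form, so the sign of \<open>\<kappa>\<close> decides
  which of the lines comes first.
\<close>

lemma asymptotic_line_fields_diagonal:
  assumes II: "\<And>a b. second_fundamental_form f x a b = \<kappa> * (w * a $ 1 * b $ 1 - a $ 2 * b $ 2)"
    and "\<kappa> < 0" "w > 0"
  shows "asymptotic_line_field1 f x = {v. v $ 1 = 1 / sqrt w * v $ 2}" (is "?A = ?A'")
    and "asymptotic_line_field2 f x = {v. v $ 1 = - (1 / sqrt w) * v $ 2}" (is "?B = ?B'")
proof -
  define g where "g = 1 / sqrt w"
  have g: "g > 0" "w * g * g = 1"
    using \<open>w > 0\<close> by (auto simp: g_def field_simps)
  have g': "w * (g * a) * (g * b) = a * b" for a b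
  proof -
    have "w * (g * a) * (g * b) = (w * g * g) * (a * b)" by (simp add: algebra_simps)
    then show ?thesis using g by simp
  qed
  have zero: "second_fundamental_form f x v v = 0 \<longleftrightarrow> v $ 1 = g * v $ 2 \<or> v $ 1 = - g * v $ 2" for v
  proof -
    have "w * v $ 1 * v $ 1 - v $ 2 * v $ 2 = w * ((v $ 1 - g * v $ 2) * (v $ 1 + g * v $ 2))"
      using g'[of "v $ 2" "v $ 2"] by (simp add: algebra_simps)
    then show ?thesis
      using assms(2,3) unfolding II by (auto simp: eq_neg_iff_add_eq_0)
  qed
  \<comment> \<open>The quantity whose sign orders the two lines; it vanishes on pairs from the same line.\<close>
  define P where "P = (\<lambda>v v'. det (vector [v, v'] :: real^2^2) * second_fundamental_form f x v v')"
  have P: "det (vector [v, v'] :: real^2^2) * second_fundamental_form f x v v' = P v v'" for v v'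
    by (simp add: P_def)
  have same: "P v v' = 0" if "v $ 1 = h * v $ 2" "v' $ 1 = h * v' $ 2" for v v' :: "real^2" and h
    using that by (simp add: P_def det_2)
  have opp: "P v v' = h * (- 4 * \<kappa>) * (v $ 2 * v' $ 2)\<^sup>2"
    if "h * h = g * g" "v $ 1 = h * v $ 2" "v' $ 1 = - h * v' $ 2" for v v' :: "real^2" and h
  proof -
    have "w * v $ 1 * v' $ 1 = - (v $ 2 * v' $ 2)"
      using g'[of "v $ 2" "v' $ 2"] that by (simp add: algebra_simps) (metis mult.assoc mult.left_commute)
    then show ?thesis
      using that by (simp add: P_def det_2 II power2_eq_square algebra_simps)
  qed
  have sgn: "h * (- 4 * \<kappa>) * y\<^sup>2 > 0 \<longleftrightarrow> h > 0 \<and> y \<noteq> 0" "h * (- 4 * \<kappa>) * y\<^sup>2 < 0 \<longleftrightarrow> h < 0 \<and> y \<noteq> 0"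
    for h y :: real
    using \<open>\<kappa> < 0\<close> by (auto simp: zero_less_mult_iff mult_less_0_iff)
  have nz: "v $ 2 \<noteq> 0" if "v $ 1 = h * v $ 2" "v \<noteq> 0" for v :: "real^2" and h
    using that by (auto simp: vec_eq_iff forall_2)
  show "?A = ?A'"
    unfolding asymptotic_line_field1_def g_def[symmetric] P
  proof (intro Collect_cong iffI; (elim conjE)?)
    fix v :: "real^2" assume "second_fundamental_form f x v v = 0"
      "v = 0 \<or> (\<exists>v'. second_fundamental_form f x v' v' = 0 \<and> 0 < P v v')"
    then show "v $ 1 = g * v $ 2"
      unfolding zero using same[of v "-g"] opp[of "-g" v] sgn(1)[of "-g"] g by fastforce
  next
    fix v :: "real^2" assume v: "v $ 1 = g * v $ 2"
    have "0 < P v (vector [-g, 1])" if "v \<noteq> 0"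
      using opp[OF refl v, of "vector [-g, 1]"] sgn(1)[of g "v $ 2"] g nz[OF v that] by simp
    then show "second_fundamental_form f x v v = 0 \<and>
      (v = 0 \<or> (\<exists>v'. second_fundamental_form f x v' v' = 0 \<and> 0 < P v v'))"
      unfolding zero using v by (auto intro!: exI[of _ "vector [-g, 1]"])
  qed
  show "?B = ?B'"
    unfolding asymptotic_line_field2_def g_def[symmetric] P
  proof (intro Collect_cong iffI; (elim conjE)?)
    fix v :: "real^2" assume "second_fundamental_form f x v v = 0"
      "v = 0 \<or> (\<exists>v'. second_fundamental_form f x v' v' = 0 \<and> P v v' < 0)"
    then show "v $ 1 = - g * v $ 2"
      unfolding zero using same[of v "g"] opp[of "g" v] sgn(2)[of "g"] g by fastforce
  next
    fix v :: "real^2" assume v: "v $ 1 = - g * v $ 2"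
    have "P v (vector [g, 1]) < 0" if "v \<noteq> 0"
      using opp[OF _ v, of "vector [g, 1]"] sgn(2)[of "-g" "v $ 2"] g nz[OF v that] by simp
    then show "second_fundamental_form f x v v = 0 \<and>
      (v = 0 \<or> (\<exists>v'. second_fundamental_form f x v' v' = 0 \<and> P v v' < 0))"
      unfolding zero using v by (auto intro!: exI[of _ "vector [g, 1]"])
  qed
qed

section \<open>Leaves of line fields invariant under translations\<close>

text \<open>
  One-sided recurrence, which is what limit sets of half-leaves require: the forward orbit of an
  irrational rotation accumulates everywhere along times that tend to infinity. Kronecker's theorem
  gives times without a lower bound; applying it to the orbit that starts at the \<open>n\<close>-th iterate
  forces them beyond \<open>n\<close>.
\<close>

lemma irrational_rotation_accumulates:
  fixes \<theta> :: real
  assumes "\<theta> \<notin> \<rat>"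
  obtains k :: "nat \<Rightarrow> nat"
  where "filterlim k at_top sequentially" "(\<lambda>n. cis (b + 2 * pi * \<theta> * real (k n))) \<longlonglongrightarrow> cis a"
proof -
  define \<delta> where "\<delta> = (\<lambda>n::nat. 1 / real (Suc n))"
  have "\<exists>k\<ge>n. \<exists>d. \<bar>d\<bar> < \<delta> n \<and> cis (b + 2 * pi * \<theta> * real k) = cis (a + 2 * pi * d)" for n
  proof -
    define t where "t = (a - b) / (2 * pi) - real n * \<theta>"
    obtain j where j: "\<bar>frac (real j * \<theta>) - frac t\<bar> < \<delta> n"
      using Kronecker_approx_1_explicit[OF assms, of "frac t" "\<delta> n"] frac_ge_0[of t] frac_lt_1[of t]
      by (auto simp: \<delta>_def less_imp_le)
    define d where "d = frac (real j * \<theta>) - frac t"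
    have *: "b + 2 * pi * \<theta> * real (n + j)
        = a + 2 * pi * d + 2 * pi * of_int (\<lfloor>real j * \<theta>\<rfloor> - \<lfloor>t\<rfloor>)"
      by (simp add: d_def frac_def t_def field_simps)
    have "cis (b + 2 * pi * \<theta> * real (n + j)) = cis (a + 2 * pi * d)"
      unfolding * cis_mult[symmetric] by (simp add: cis_multiple_2pi)
    then show ?thesis
      using j by (intro exI[of _ "n + j"] conjI exI[of _ d]) (auto simp: d_def)
  qed
  then obtain k d where k: "\<And>n. k n \<ge> n" "\<And>n. \<bar>d n\<bar> < \<delta> n"
      "\<And>n. cis (b + 2 * pi * \<theta> * real (k n)) = cis (a + 2 * pi * d n)"
    by metis
  have "\<delta> \<longlonglongrightarrow> 0"
    unfolding \<delta>_def using LIMSEQ_inverse_real_of_nat by (simp add: inverse_eq_divide)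
  then have "d \<longlonglongrightarrow> 0"
    by (rule Lim_null_comparison[rotated]) (use k(2) in \<open>auto intro!: always_eventually less_imp_le\<close>)
  then have "(\<lambda>n. cis (a + 2 * pi * d n)) \<longlonglongrightarrow> cis (a + 2 * pi * 0)"
    by (intro tendsto_cis tendsto_intros)
  moreover have "filterlim k at_top sequentially"
    using filterlim_at_top_mono[OF filterlim_ident always_eventually[OF allI[OF k(1)]]] .
  ultimately show thesis
    using that[of k] k(3) by simp
qed

lemma continuous_has_antiderivative:
  fixes g :: "real \<Rightarrow> real"
  assumes "continuous_on UNIV g"
  obtains G where "\<And>x. (G has_real_derivative g x) (at x)"
proof -
  have "\<exists>F. \<forall>x::real. - \<infinity> < ereal x \<longrightarrow> ereal x < \<infinity> \<longrightarrow> (F has_vector_derivative g x) (at x)"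
    using assms by (intro einterval_antiderivative) (auto simp: continuous_on_eq_continuous_at)
  then show thesis
    using that by (auto simp: has_real_derivative_iff_has_vector_derivative)
qed

text \<open>
  This produces the rigid rotation: if \<open>G\<close> is the height of a curve over its coordinate \<open>x\<close>, each period
  adds the same amount to it.
\<close>

lemma antiderivative_of_periodic:
  fixes g :: "real \<Rightarrow> real"
  assumes per: "\<And>x. g (x + p) = g x" and G: "\<And>x. (G has_real_derivative g x) (at x)"
  shows "G (x + real n * p) = G x + real n * (G p - G 0)"
proof -
  have 1: "G (x + p) = G x + (G p - G 0)" for x
  proof -
    have "((\<lambda>x. G (x + p) - G x) has_real_derivative 0) (at x)" for x
      using DERIV_diff[OF DERIV_shift[THEN iffD1, OF G[of "x + p"]] G[of x]] per by simp
    then have "G (x + p) - G x = G (0 + p) - G 0"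
      by (rule DERIV_isconst_all[rule_format])
    then show ?thesis by simp
  qed
  show ?thesis
  proof (induction n)
    case (Suc n)
    have "x + real (Suc n) * p = x + real n * p + p" by (simp add: algebra_simps)
    then show ?case using 1[of "x + real n * p"] Suc by (simp add: algebra_simps)
  qed simp
qed

text \<open>
  Used to parametrize leaves by arc length: \<open>Q\<close> is arc length as a function of a coordinate, and \<open>R\<close>
  is the coordinate as a function of arc length. The lower bound \<open>m\<close> is what makes \<open>Q\<close> surjective, so
  that leaves exist for all time.
\<close>

lemma antiderivative_inverse:
  fixes q :: "real \<Rightarrow> real"
  assumes Q: "\<And>x. (Q has_real_derivative q x) (at x)" and q: "\<And>x. q x \<ge> m" and "m > 0"
  obtains R where "\<And>x. Q (R x) = x" "\<And>x. R (Q x) = x"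
    "\<And>x. (R has_real_derivative inverse (q (R x))) (at x)" "filterlim Q at_top at_top"
proof -
  have cont: "continuous_on A Q" for A
    by (rule DERIV_continuous_on[OF has_field_derivative_at_within[OF Q]])
  have pos: "q x > 0" for x using q[of x] \<open>m > 0\<close> by simp
  have mono: "strict_mono Q"
  proof (rule strict_monoI)
    fix x y :: real assume "x < y"
    then show "Q x < Q y"
      using Q pos by (intro DERIV_pos_imp_increasing[of x y Q]) auto
  qed
  \<comment> \<open>Comparison with the linear function of slope \<open>m\<close> shows that \<open>Q\<close> is unbounded in both directions.\<close>
  have mon: "mono (\<lambda>x. Q x - m * x)"
  proof (intro monoI)
    fix x y :: real assume "x \<le> y"
    moreover have "((\<lambda>x. Q x - m * x) has_real_derivative q z - m) (at z)" for z
      by (rule derivative_eq_intros Q refl | simp)+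
    then have "\<exists>d. ((\<lambda>x. Q x - m * x) has_real_derivative d) (at z) \<and> d \<ge> 0" for z
      using q[of z] by (intro exI[of _ "q z - m"]) simp
    ultimately show "Q x - m * x \<le> Q y - m * y"
      by (intro DERIV_nonneg_imp_nondecreasing[of x y "\<lambda>x. Q x - m * x"])
  qed
  have hi: "Q x \<ge> Q 0 + m * x" if "x \<ge> 0" for x
    using monoD[OF mon that] by simp
  have lo: "Q x \<le> Q 0 + m * x" if "x \<le> 0" for x
    using monoD[OF mon that] by simp
  have "\<exists>x. Q x = y" for y
  proof -
    define r where "r = \<bar>y - Q 0\<bar> / m"
    have "r \<ge> 0" "m * r = \<bar>y - Q 0\<bar>" using \<open>m > 0\<close> by (auto simp: r_def)
    then have "Q (-r) \<le> y" "y \<le> Q r"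
      using hi[of r] lo[of "-r"] by auto
    then show ?thesis
      using IVT'[of Q "-r" y r] cont \<open>r \<ge> 0\<close> by auto
  qed
  then obtain R where R: "\<And>y. Q (R y) = y" by metis
  have RQ: "R (Q x) = x" for x
    using R strict_mono_eq[OF mono] by blast
  have "isCont R (Q z)" for z
    by (rule isCont_inverse_function[where d=1 and f=Q and x=z]) (use RQ cont[of UNIV] in \<open>auto simp: continuous_on_eq_continuous_at\<close>)
  then have "isCont R x" for x
    using R[of x] by metis
  then have "(R has_real_derivative inverse (q (R x))) (at x)" for x
    using pos[of "R x"] by (intro DERIV_inverse_function[OF Q, of _ _ "x - 1" "x + 1"]) (auto simp: R)
  moreover have "filterlim Q at_top at_top"
  proof (rule filterlim_at_top_mono)
    show "filterlim (\<lambda>x. Q 0 + m * x) at_top at_top"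
      using \<open>m > 0\<close>
      by (intro filterlim_tendsto_add_at_top[OF tendsto_const] filterlim_tendsto_pos_mult_at_top[OF tendsto_const] filterlim_ident)
    show "\<forall>\<^sub>F x in at_top. Q 0 + m * x \<le> Q x"
      using eventually_ge_at_top[of 0] by eventually_elim (rule hi)
  qed
  ultimately show thesis using that R RQ by blast
qed

lemma continuous_periodic_pos_bounded_below:
  fixes q :: "real \<Rightarrow> real"
  assumes "continuous_on UNIV q" "\<And>x. q (x + p) = q x" "p > 0" "\<And>x. q x > 0"
  obtains m where "m > 0" "\<And>x. q x \<ge> m"
proof -
  obtain y where y: "y \<in> {0..p}" "\<And>x. x \<in> {0..p} \<Longrightarrow> q y \<le> q x"
    using continuous_attains_inf[of "{0..p}" q] continuous_on_subset[OF assms(1)] \<open>p > 0\<close> by force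
  have per: "q (x + real n * p) = q x" for x n
  proof (induction n)
    case (Suc n)
    then show ?case using assms(2)[of "x + real n * p"] by (simp add: algebra_simps)
  qed simp
  have "q y \<le> q x" for x
  proof -
    define i where "i = \<lfloor>x / p\<rfloor>"
    have r: "x - of_int i * p \<in> {0..p}"
      using floor_divide_lower[OF \<open>p > 0\<close>, of x] floor_divide_upper[OF \<open>p > 0\<close>, of x] 
      by (auto simp: i_def algebra_simps)
    have "q x = q (x - of_int i * p)"
    proof (cases "i \<ge> 0")
      case True
      then show ?thesis using per[of "x - of_int i * p" "nat i"] by simp
    next
      case False
      then show ?thesis using per[of x "nat (- i)"] by simp
    qed
    then show ?thesis using y(2)[OF r] by simp
  qed
  then show thesis using that[of "q y"] assms(4) by blast
qed

lemma torus_cover_range: "range torus_cover = torus"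
proof
  show "torus \<subseteq> range torus_cover"
  proof
    fix p assume "p \<in> torus"
    then obtain z w where p: "p = (z, w)" "norm z = 1" "norm w = 1"
      by (auto simp: torus_def)
    then have "p = torus_cover (vector [Arg z, Arg w])"
      using cis_Arg_unique rcis_cmod_Arg[of z] rcis_cmod_Arg[of w] by (simp add: torus_cover_def rcis_def)
    then show "p \<in> range torus_cover" by blast
  qed
qed (auto simp: torus_cover_def torus_def)

lemma limit_sets_subset_closed:
  assumes "closed A" "\<And>t. t \<in> I \<Longrightarrow> \<gamma> t \<in> A"
  shows "alpha_limit_set I \<gamma> \<union> omega_limit_set I \<gamma> \<subseteq> A"
proof -
  have "p \<in> A" if "\<forall>n. s n \<in> I" "(\<lambda>n. \<gamma> (s n)) \<longlonglongrightarrow> p" for s :: "nat \<Rightarrow> real" and p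
    by (rule closed_sequentially[OF assms(1) _ that(2)]) (use assms(2) that(1) in simp)
  then show ?thesis
    unfolding alpha_limit_set_def omega_limit_set_def by blast
qed

text \<open>
  Along an integral curve the second coordinate moves with velocity \<open>\<plusminus> 1 / q\<close>, hence never turns
  back, and \<open>Q\<close> of it is affine in time. The slope field depends on the second coordinate only, so the
  first coordinate is \<open>G\<close> of the second up to a constant. These two formulas make sense for all times
  and define an extension to the whole line, so a maximal curve is complete.
\<close>

lemma maximal_integral_curve_form:
  assumes hyp: "hyperbolic_region \<alpha> = torus"
    and L: "\<And>x v. v \<in> L x \<longleftrightarrow> v $ 1 = g (x $ 2) * v $ 2"
    and speed: "\<And>x v. v \<in> L x \<Longrightarrow>
      norm (frechet_derivative (\<alpha> \<circ> torus_cover) (at x) v) = q (x $ 2) * \<bar>v $ 2\<bar>"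
    and cont: "continuous_on UNIV g" "continuous_on UNIV q"
    and q: "\<And>y. q y \<ge> m" "m > 0"
    and G: "\<And>y. (G has_real_derivative g y) (at y)"
    and Q: "\<And>y. (Q has_real_derivative q y) (at y)"
    and c: "maximal_integral_curve \<alpha> L I c"
  obtains \<tau> k K where "I = UNIV" "\<tau> = 1 \<or> \<tau> = (-1::real)"
    "\<And>t. Q (c t $ 2) = \<tau> * t + k" "\<And>t. c t $ 1 = K + G (c t $ 2)"
proof -
  have pos: "q y > 0" for y using q(1)[of y] q(2) by simp
  obtain R where R: "\<And>y. Q (R y) = y" "\<And>y. R (Q y) = y"
    "\<And>y. (R has_real_derivative inverse (q (R y))) (at y)"
    using antiderivative_inverse[OF Q q] by metis
  have ic: "integral_curve \<alpha> L I c" and max: "\<And>J d. integral_curve \<alpha> L J d \<Longrightarrow> I \<subseteq> J \<Longrightarrow>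
      (\<And>t. t \<in> I \<Longrightarrow> d t = c t) \<Longrightarrow> J = I"
    using c unfolding maximal_integral_curve_def by blast+
  have I: "open I" "convex I" "I \<noteq> {}"
    using ic by (auto simp: integral_curve_def is_interval_convex_1)
  obtain c' where c': "continuous_on I c'" "\<And>t. t \<in> I \<Longrightarrow> (c has_vector_derivative c' t) (at t)"
    "\<And>t. t \<in> I \<Longrightarrow> c' t \<in> L (c t)"
    "\<And>t. t \<in> I \<Longrightarrow> norm (frechet_derivative (\<alpha> \<circ> torus_cover) (at (c t)) (c' t)) = 1"
    using ic unfolding integral_curve_def by blast
  have d: "((\<lambda>t. c t $ i) has_real_derivative c' t $ i) (at t)" if "t \<in> I" for t i
    using bounded_linear.has_vector_derivative[OF bounded_linear_vec_nth c'(2)[OF that], of i]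
    by (simp add: has_real_derivative_iff_has_vector_derivative)
  have contc: "continuous_on I (\<lambda>t. c t $ i)" for i
    using d by (meson DERIV_isCont continuous_at_imp_continuous_on)
  \<comment> \<open>Unit speed makes \<open>s\<close> a continuous function with values in \<open>{1, -1}\<close>, hence constant.\<close>
  define s where "s = (\<lambda>t. q (c t $ 2) * c' t $ 2)"
  have s1: "s t \<in> {1, -1}" if "t \<in> I" for t
  proof -
    have "q (c t $ 2) * \<bar>c' t $ 2\<bar> = 1"
      using speed[OF c'(3)[OF that]] c'(4)[OF that] by simp
    then have "\<bar>s t\<bar> = 1"
      using pos[of "c t $ 2"] by (simp add: s_def abs_mult)
    then show ?thesis by auto
  qed
  have "s constant_on I"
  proof (rule continuous_finite_range_constant)
    show "continuous_on I s"
      unfolding s_def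
      by (intro continuous_on_mult continuous_on_compose2[OF cont(2) contc]
          continuous_on_component c'(1)) auto
    show "finite (s ` I)"
      by (rule finite_subset[of _ "{1,-1}"]) (use s1 in auto)
  qed (use I in \<open>simp add: convex_connected\<close>)
  then obtain \<tau> where \<tau>: "\<And>t. t \<in> I \<Longrightarrow> s t = \<tau>"
    by (auto simp: constant_on_def)
  with s1 I have \<tau>1: "\<tau> = 1 \<or> \<tau> = -1" by fastforce
  have const: "\<exists>C. \<forall>t\<in>I. h t = C" if "\<And>t. t \<in> I \<Longrightarrow> (h has_real_derivative 0) (at t)" for h
    using has_field_derivative_zero_constant[OF I(2), of h] that has_field_derivative_at_within by blast
  have "\<exists>C. \<forall>t\<in>I. Q (c t $ 2) - \<tau> * t = C"
  proof (rule const)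
    fix t assume t: "t \<in> I"
    show "((\<lambda>t. Q (c t $ 2) - \<tau> * t) has_real_derivative 0) (at t)"
      by (rule derivative_eq_intros DERIV_chain2[OF Q] d[OF t] refl)+
        (use \<tau>[OF t] in \<open>simp add: s_def\<close>)
  qed
  then obtain k where "\<And>t. t \<in> I \<Longrightarrow> Q (c t $ 2) - \<tau> * t = k" by blast
  then have k: "\<And>t. t \<in> I \<Longrightarrow> Q (c t $ 2) = \<tau> * t + k" by fastforce
  have "\<exists>C. \<forall>t\<in>I. c t $ 1 - G (c t $ 2) = C"
  proof (rule const)
    fix t assume t: "t \<in> I"
    show "((\<lambda>t. c t $ 1 - G (c t $ 2)) has_real_derivative 0) (at t)"
      by (rule derivative_eq_intros DERIV_chain2[OF G] d[OF t] refl)+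
        (use c'(3)[OF t] in \<open>simp add: L\<close>)
  qed
  then obtain K where "\<And>t. t \<in> I \<Longrightarrow> c t $ 1 - G (c t $ 2) = K" by blast
  then have K: "\<And>t. t \<in> I \<Longrightarrow> c t $ 1 = K + G (c t $ 2)" by fastforce
  \<comment> \<open>The extension \<open>e\<close> of the curve to all times, with velocity \<open>e'\<close>.\<close>
  define y where "y = (\<lambda>t. R (\<tau> * t + k))"
  define e where "e = (\<lambda>t. vector [K + G (y t), y t] :: real^2)"
  define y' where "y' = (\<lambda>t. inverse (q (y t)) * \<tau>)"
  define e' where "e' = (\<lambda>t. vector [g (y t) * y' t, y' t] :: real^2)"
  have e_nth [simp]: "e t $ 1 = K + G (y t)" "e t $ 2 = y t"
    "e' t $ 1 = g (y t) * y' t" "e' t $ 2 = y' t" for t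
    by (auto simp: e_def e'_def)
  have Dy: "(y has_real_derivative y' t) (at t)" for t
    unfolding y_def y'_def by (rule derivative_eq_intros DERIV_chain2[OF R(3)] refl | simp)+
  have conty: "continuous_on UNIV y"
    using Dy by (meson DERIV_isCont continuous_at_imp_continuous_on)
  have ie: "integral_curve \<alpha> L UNIV e"
    unfolding integral_curve_def
  proof (intro conjI ballI exI[of _ e'])
    fix t :: real
    show "torus_cover (e t) \<in> hyperbolic_region \<alpha>"
      using hyp torus_cover_range by blast
    have "((\<lambda>t. K + G (y t)) has_real_derivative g (y t) * y' t) (at t)"
      by (rule derivative_eq_intros DERIV_chain2[OF G] Dy refl | simp)+
    with Dy have "((\<lambda>t. e t $ i) has_vector_derivative e' t $ i) (at t)" for i
      using exhaust_2[of i] by (auto simp: has_real_derivative_iff_has_vector_derivative)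
    then show "(e has_vector_derivative e' t) (at t)"
      unfolding has_vector_derivative_def
      by (subst has_derivative_componentwise_within) (auto simp: Basis_vec_def inner_axis)
    show "e' t \<in> L (e t)" by (simp add: L)
    from speed[OF this] show "norm (frechet_derivative (\<alpha> \<circ> torus_cover) (at (e t)) (e' t)) = 1"
      using \<tau>1 pos[of "y t"] by (auto simp: y'_def abs_mult)
  next
    have conty': "continuous_on UNIV y'"
      unfolding y'_def using less_imp_neq[OF pos]
      by (intro continuous_intros continuous_on_compose2[OF cont(2) conty]) auto
    have "continuous_on UNIV (\<lambda>t. g (y t) * y' t)"
      by (intro continuous_on_mult conty' continuous_on_compose2[OF cont(1) conty]) auto
    with conty' have "continuous_on UNIV (\<lambda>t. e' t $ i)" for i
      using exhaust_2[of i] by auto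
    then show "continuous_on UNIV e'"
      by (subst continuous_on_componentwise) (auto simp: Basis_vec_def inner_axis)
  qed auto
  have ec: "e t = c t" if "t \<in> I" for t
  proof -
    have "y t = c t $ 2"
      using k[OF that] R(2)[of "c t $ 2"] by (simp add: y_def)
    then show ?thesis
      using K[OF that] by (simp add: vec_eq_iff forall_2)
  qed
  have "I = UNIV" using max[OF ie _ ec] by simp
  then show thesis using that[OF _ \<tau>1, of k K] k K by simp
qed

text \<open>
  The leaf meets the circle where the second angle is \<open>b\<close> once in each period, and successive points
  of intersection differ by the rotation through \<open>2 \<pi> \<rho>\<close>. As this is irrational, the points with first
  angle close to \<open>a\<close> recur for arbitrarily large values of the second coordinate. Those values are
  reached in the distant future or in the distant past, depending on the direction \<open>\<tau>\<close> of the curve;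
  accordingly \<open>(cis a, cis b)\<close> lies in one or the other of the two limit sets.
\<close>

lemma maximal_integral_curve_dense:
  assumes hyp: "hyperbolic_region \<alpha> = torus"
    and L: "\<And>x v. v \<in> L x \<longleftrightarrow> v $ 1 = g (x $ 2) * v $ 2"
    and speed: "\<And>x v. v \<in> L x \<Longrightarrow>
      norm (frechet_derivative (\<alpha> \<circ> torus_cover) (at x) v) = q (x $ 2) * \<bar>v $ 2\<bar>"
    and cont: "continuous_on UNIV g" "continuous_on UNIV q"
    and per: "\<And>y. g (y + 2 * pi) = g y" "\<And>y. q (y + 2 * pi) = q y"
    and pos: "\<And>y. q y > 0"
    and irrational: "integral {0..2 * pi} g / (2 * pi) \<notin> \<rat>"
    and c: "maximal_integral_curve \<alpha> L I c"
  shows "dense_leaf (I, torus_cover \<circ> c)"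
proof -
  obtain m where m: "m > 0" "\<And>y. q y \<ge> m"
    using continuous_periodic_pos_bounded_below[OF cont(2) per(2) _ pos] by auto
  obtain G where G: "\<And>y. (G has_real_derivative g y) (at y)"
    using continuous_has_antiderivative[OF cont(1)] by blast
  obtain Q where Q: "\<And>y. (Q has_real_derivative q y) (at y)"
    using continuous_has_antiderivative[OF cont(2)] by blast
  have Q_top: "filterlim Q at_top at_top"
    using antiderivative_inverse[OF Q m(2,1)] by metis
  have Q_inj: "Q y = Q z \<Longrightarrow> y = z" for y z
    using antiderivative_inverse[OF Q m(2,1)] by metis
  obtain \<tau> k K where I: "I = UNIV" and \<tau>: "\<tau> = 1 \<or> \<tau> = -1"
    and c2: "\<And>t. Q (c t $ 2) = \<tau> * t + k" and c1: "\<And>t. c t $ 1 = K + G (c t $ 2)"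
    using maximal_integral_curve_form[OF hyp L speed cont m(2,1) G Q c] by metis
  define \<rho> where "\<rho> = integral {0..2 * pi} g / (2 * pi)"
  have "(g has_integral G (2 * pi) - G 0) {0..2 * pi}"
    using G by (intro fundamental_theorem_of_calculus)
      (auto simp: has_real_derivative_iff_has_vector_derivative[symmetric] has_field_derivative_at_within)
  then have \<rho>: "G (2 * pi) - G 0 = 2 * pi * \<rho>"
    by (simp add: \<rho>_def integral_unique)
  have "p \<in> alpha_limit_set I (torus_cover \<circ> c) \<union> omega_limit_set I (torus_cover \<circ> c)" if p: "p \<in> torus" for p
  proof -
    obtain a b where ab: "p = (cis a, cis b)"
      using p torus_cover_range unfolding torus_cover_def by blast
    obtain n where n: "filterlim n at_top sequentially"
      "(\<lambda>j. cis (K + G b + 2 * pi * \<rho> * real (n j))) \<longlonglongrightarrow> cis a"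
      using irrational_rotation_accumulates[of \<rho> "K + G b" a] irrational by (auto simp: \<rho>_def)
    define y where "y = (\<lambda>j. b + real (n j) * (2 * pi))"
    \<comment> \<open>The time at which the second coordinate is \<open>y j\<close>, using \<open>\<tau> = 1 / \<tau>\<close>.\<close>
    define s where "s = (\<lambda>j. \<tau> * (Q (y j) - k))"
    have \<tau>\<tau>: "\<tau> * \<tau> = 1" using \<tau> by auto
    have cs: "c (s j) $ 2 = y j" for j
      by (rule Q_inj) (use c2[of "s j"] \<tau>\<tau> in \<open>simp add: s_def mult.assoc[symmetric]\<close>)
    have "torus_cover (c (s j)) = (cis (K + G b + 2 * pi * \<rho> * real (n j)), cis b)" for j
    proof -
      have "G (y j) = G b + 2 * pi * \<rho> * real (n j)"
        using antiderivative_of_periodic[OF per(1) G, of b "n j"] by (simp add: y_def \<rho>)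
      moreover have "cis (y j) = cis b * cis (2 * pi * real (n j))"
        by (simp add: y_def cis_mult mult_ac)
      ultimately show ?thesis
        by (simp add: torus_cover_def c1 cs add.assoc cis_multiple_2pi)
    qed
    then have lim: "(\<lambda>j. (torus_cover \<circ> c) (s j)) \<longlonglongrightarrow> p"
      using n(2) by (auto simp: ab intro!: tendsto_Pair)
    have "filterlim y at_top sequentially"
      unfolding y_def using n(1)
      by (intro filterlim_tendsto_add_at_top[OF tendsto_const]
          filterlim_at_top_mult_tendsto_pos[OF tendsto_const]
          filterlim_compose[OF filterlim_real_sequentially]) auto
    then have Qy: "filterlim (\<lambda>j. Q (y j)) at_top sequentially"
      by (rule filterlim_compose[OF Q_top])
    show ?thesis
      using \<tau>
    proof
      assume "\<tau> = 1"
      then have "\<forall>\<^sub>F j in sequentially. t < s j" for t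
        using filterlim_at_top_dense[THEN iffD1, OF Qy, rule_format, of "t + k"]
        by (auto simp: s_def algebra_simps)
      then show ?thesis using lim by (auto simp: omega_limit_set_def I)
    next
      assume "\<tau> = -1"
      then have "\<forall>\<^sub>F j in sequentially. s j < t" for t
        using filterlim_at_top_dense[THEN iffD1, OF Qy, rule_format, of "k - t"]
        by (auto simp: s_def algebra_simps)
      then show ?thesis using lim by (auto simp: alpha_limit_set_def I)
    qed
  qed
  moreover have "alpha_limit_set I (torus_cover \<circ> c) \<union> omega_limit_set I (torus_cover \<circ> c) \<subseteq> torus"
    using torus_cover_range by (intro limit_sets_subset_closed) (auto simp: torus_def closed_Times)
  ultimately show ?thesis
    unfolding dense_leaf_def by auto
qed

section \<open>A family of rotation tori\<close>

text \<open>
  Below, \<open>w\<close> is the profile, \<open>w'\<close> its derivative, and \<open>e\<close> measures the deviation from the Clifford torus;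
  \<open>\<bar>e\<bar> < 1\<close> keeps \<open>w\<close> positive. All vectors are best read in the orthonormal frame
  \<open>E1 = (cis u, 0)\<close>, \<open>E2 = (i cis u, 0)\<close>, \<open>E3 = (0, cis v)\<close>, \<open>E4 = (0, i cis v)\<close>, where \<open>u\<close> and \<open>v\<close> are the coordinates
  of the point \<open>x\<close> of the plane.
\<close>

locale rotation_torus =
  fixes e :: real
  assumes e: "\<bar>e\<bar> < 1"
begin

definition w where "w t = 1 + e * cos t"
definition w' where "w' t = - e * sin t"
definition f_scale where "f_scale t = 1 / sqrt (1 + (w t)\<^sup>2)"
definition n_scale where "n_scale t = 1 / sqrt (1 + (w t)\<^sup>2 + (w' t)\<^sup>2)"

definition \<alpha> :: "complex \<times> complex \<Rightarrow> real^4" where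
  "\<alpha> = (\<lambda>(z, u). let r = 1 + e * Re u in
     (1 / sqrt (1 + r\<^sup>2)) *\<^sub>R vector [r * Re z, r * Im z, Re u, Im u])"

abbreviation f where "f \<equiv> \<alpha> \<circ> torus_cover"

text \<open>
  The position vector \<open>F = w E1 + E3\<close> before normalization.
\<close>

definition f_vec :: "real^2 \<Rightarrow> real^4" where
  "f_vec x = vector [w (x $ 2) * cos (x $ 1), w (x $ 2) * sin (x $ 1), cos (x $ 2), sin (x $ 2)]"
definition parallel :: "real^2 \<Rightarrow> real^4" where
  "parallel x = vector [- sin (x $ 1), cos (x $ 1), 0, 0]"
text \<open>
  The direction of the curves \<open>u = const\<close> on the sphere, \<open>w' E1 - w w' E3 + (1 + w\<^sup>2) E4\<close>. It is the part of the
  \<open>v\<close>-derivative \<open>w' E1 + E4\<close> of \<open>F\<close> that is orthogonal to \<open>F\<close>, multiplied by \<open>\<bar>F\<bar>\<^sup>2 = 1 + w\<^sup>2\<close> to clear denominators.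
\<close>

definition meridian :: "real^2 \<Rightarrow> real^4" where
  "meridian x = (let k = w (x $ 2); k' = w' (x $ 2) in
     vector [k' * cos (x $ 1), k' * sin (x $ 1),
       - k * k' * cos (x $ 2) - (1 + k\<^sup>2) * sin (x $ 2), - k * k' * sin (x $ 2) + (1 + k\<^sup>2) * cos (x $ 2)])"
text \<open>
  The normal direction \<open>E1 - w E3 - w' E4\<close>, solved for from orthogonality to \<open>F\<close> and to both of its derivatives.
\<close>

definition n_vec :: "real^2 \<Rightarrow> real^4" where
  "n_vec x = (let k = w (x $ 2); k' = w' (x $ 2) in
     vector [cos (x $ 1), sin (x $ 1), - k * cos (x $ 2) + k' * sin (x $ 2), - k * sin (x $ 2) - k' * cos (x $ 2)])"

lemma w_pos: "w t > 0"
proof -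
  have "\<bar>e * cos t\<bar> \<le> \<bar>e\<bar>" by (simp add: abs_mult mult_left_le)
  then show ?thesis using e by (simp add: w_def abs_le_iff)
qed

lemma f_scale_pos: "f_scale t > 0" and n_scale_pos: "n_scale t > 0"
  by (simp_all add: f_scale_def n_scale_def add_pos_nonneg)

text \<open>
  The cubes arise by differentiating an inverse square root; these identities remove them again.
\<close>

lemma f_scale_power: "(f_scale t)\<^sup>2 * (1 + (w t)\<^sup>2) = 1" "f_scale t ^ 3 * (1 + (w t)\<^sup>2) = f_scale t"
proof -
  have "1 + (w t)\<^sup>2 > 0" by (simp add: add_pos_nonneg)
  then show *: "(f_scale t)\<^sup>2 * (1 + (w t)\<^sup>2) = 1"
    by (simp add: f_scale_def power_divide)
  show "f_scale t ^ 3 * (1 + (w t)\<^sup>2) = f_scale t"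
    using * by (simp add: power3_eq_cube power2_eq_square)
qed

lemma n_scale_power: "(n_scale t)\<^sup>2 * (1 + (w t)\<^sup>2 + (w' t)\<^sup>2) = 1" "n_scale t ^ 3 * (1 + (w t)\<^sup>2 + (w' t)\<^sup>2) = n_scale t"
proof -
  have "1 + (w t)\<^sup>2 + (w' t)\<^sup>2 > 0" by (simp add: add_pos_nonneg)
  then show *: "(n_scale t)\<^sup>2 * (1 + (w t)\<^sup>2 + (w' t)\<^sup>2) = 1"
    by (simp add: n_scale_def power_divide)
  show "n_scale t ^ 3 * (1 + (w t)\<^sup>2 + (w' t)\<^sup>2) = n_scale t"
    using * by (simp add: power3_eq_cube power2_eq_square)
qed

text \<open>
  The second equation, \<open>w'' = 1 - w\<close>, is the reason for the choice of \<open>w\<close>: it makes the coefficient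
  \<open>w + w''\<close> of \<open>dv\<^sup>2\<close> in the second fundamental form equal to 1.
\<close>

lemma DERIV_w: "(w has_real_derivative w' t) (at t)"
  and DERIV_w': "(w' has_real_derivative 1 - w t) (at t)"
  unfolding w_def w'_def by (rule derivative_eq_intros refl | simp)+

lemma DERIV_f_scale: "(f_scale has_real_derivative - w t * w' t * f_scale t ^ 3) (at t)"
  unfolding f_scale_def
  by (rule DERIV_cong, rule DERIV_inverse_sqrt, (rule derivative_eq_intros DERIV_w refl)+)
     (simp_all add: add_pos_nonneg)

lemma DERIV_n_scale: "(n_scale has_real_derivative - w' t * n_scale t ^ 3) (at t)"
  unfolding n_scale_def
  by (rule DERIV_cong, rule DERIV_inverse_sqrt, (rule derivative_eq_intros DERIV_w DERIV_w' refl)+)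
     (simp_all add: add_pos_nonneg algebra_simps)

lemma f_eq: "f x = f_scale (x $ 2) *\<^sub>R f_vec x"
  by (simp add: \<alpha>_def torus_cover_def f_scale_def f_vec_def w_def Let_def)

lemma inner_parallel: "parallel x \<bullet> parallel x = 1"
  unfolding inner_4 parallel_def meridian_def f_vec_def n_vec_def Let_def vector_4
  using sin_cos_squared_add[of "x $ 1"] sin_cos_squared_add[of "x $ 2"] by algebra

lemma inner_parallel_meridian: "parallel x \<bullet> meridian x = 0"
  by (simp add: inner_4 parallel_def meridian_def Let_def)

lemma inner_meridian: "meridian x \<bullet> meridian x = (1 + (w (x $ 2))\<^sup>2) * (1 + (w (x $ 2))\<^sup>2 + (w' (x $ 2))\<^sup>2)"
  unfolding inner_4 parallel_def meridian_def f_vec_def n_vec_def Let_def vector_4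
  using sin_cos_squared_add[of "x $ 1"] sin_cos_squared_add[of "x $ 2"] by algebra

lemma inner_f_vec: "f_vec x \<bullet> f_vec x = 1 + (w (x $ 2))\<^sup>2"
  unfolding inner_4 parallel_def meridian_def f_vec_def n_vec_def Let_def vector_4
  using sin_cos_squared_add[of "x $ 1"] sin_cos_squared_add[of "x $ 2"] by algebra

lemma inner_n_vec: "n_vec x \<bullet> n_vec x = 1 + (w (x $ 2))\<^sup>2 + (w' (x $ 2))\<^sup>2"
  unfolding inner_4 parallel_def meridian_def f_vec_def n_vec_def Let_def vector_4
  using sin_cos_squared_add[of "x $ 1"] sin_cos_squared_add[of "x $ 2"] by algebra

text \<open>
  This fixes the sign of the unit normal: the multiple of \<open>n_vec\<close> is positive.
\<close>

lemma wedge3_frame: "wedge3 (f_vec x) (parallel x) (meridian x) = (1 + (w (x $ 2))\<^sup>2) *\<^sub>R n_vec x"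
  by (rule vector_4_eqI; unfold vector_scaleR_component wedge3_nth parallel_def meridian_def f_vec_def
      n_vec_def Let_def vector_4 real_scaleR_def;
      use sin_cos_squared_add[of "x $ 1"] sin_cos_squared_add[of "x $ 2"] in algebra)

lemma has_derivative_f:
  "(f has_derivative (\<lambda>a. a $ 1 *\<^sub>R ((f_scale (x $ 2) * w (x $ 2)) *\<^sub>R parallel x)
      + a $ 2 *\<^sub>R (f_scale (x $ 2) ^ 3 *\<^sub>R meridian x))) (at x)"
proof (rule has_derivative_coordinates)
  fix i :: 4
  let ?s = "f_scale (x $ 2)" and ?k = "w (x $ 2)" and ?k' = "w' (x $ 2)"
  have 1: "((\<lambda>t. f_scale t * w t) has_real_derivative ?s ^ 3 * ?k') (at (x $ 2))"
    by (rule derivative_eq_intros DERIV_w DERIV_f_scale refl)+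
      (use arg_cong[OF f_scale_power(2)[of "x $ 2"], of "\<lambda>y. ?k' * y"] in \<open>simp add: algebra_simps power2_eq_square\<close>)
  have 2: "((\<lambda>t. f_scale t * cos t) has_real_derivative
      ?s ^ 3 * (- ?k * ?k' * cos (x $ 2) - (1 + ?k\<^sup>2) * sin (x $ 2))) (at (x $ 2))"
    by (rule derivative_eq_intros DERIV_f_scale refl)+
      (use arg_cong[OF f_scale_power(2)[of "x $ 2"], of "\<lambda>y. sin (x $ 2) * y"] in \<open>simp add: algebra_simps power2_eq_square\<close>)
  have 3: "((\<lambda>t. f_scale t * sin t) has_real_derivative
      ?s ^ 3 * (- ?k * ?k' * sin (x $ 2) + (1 + ?k\<^sup>2) * cos (x $ 2))) (at (x $ 2))"
    by (rule derivative_eq_intros DERIV_f_scale refl)+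
      (use arg_cong[OF f_scale_power(2)[of "x $ 2"], of "\<lambda>y. cos (x $ 2) * y"] in \<open>simp add: algebra_simps power2_eq_square\<close>)
  note d = has_derivative_of_coordinate[of _ _ x]
  have 4: "((\<lambda>x. f_scale (x $ 2) * w (x $ 2) * cos (x $ 1)) has_derivative
      (\<lambda>a. a $ 1 * (?s * ?k * - sin (x $ 1)) + a $ 2 * (?s ^ 3 * (?k' * cos (x $ 1))))) (at x)"
    by (rule has_derivative_eq_rhs, rule has_derivative_mult, rule d[OF 1], rule d[OF DERIV_cos])
      (auto simp: algebra_simps)
  have 5: "((\<lambda>x. f_scale (x $ 2) * w (x $ 2) * sin (x $ 1)) has_derivative
      (\<lambda>a. a $ 1 * (?s * ?k * cos (x $ 1)) + a $ 2 * (?s ^ 3 * (?k' * sin (x $ 1))))) (at x)"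
    by (rule has_derivative_eq_rhs, rule has_derivative_mult, rule d[OF 1], rule d[OF DERIV_sin])
      (auto simp: algebra_simps)
  show "((\<lambda>x. f x $ i) has_derivative
      (\<lambda>a. a $ 1 * ((?s * ?k) *\<^sub>R parallel x) $ i + a $ 2 * (?s ^ 3 *\<^sub>R meridian x) $ i)) (at x)"
    unfolding f_eq using exhaust_4[of i] 4 5 d[OF 2] d[OF 3]
    by (auto simp: f_vec_def parallel_def meridian_def Let_def mult.assoc)
qed

lemmas frechet_f = frechet_derivative_at[OF has_derivative_f, symmetric]

lemma unit_normal_f: "unit_normal f x = n_scale (x $ 2) *\<^sub>R n_vec x"
proof -
  let ?s = "f_scale (x $ 2)" and ?k = "w (x $ 2)"
  define c where "c = ?s * (?s * ?k) * ?s ^ 3 * (1 + ?k\<^sup>2)"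
  have "c > 0" using f_scale_pos[of "x $ 2"] w_pos[of "x $ 2"] by (simp add: c_def add_pos_nonneg)
  have "frechet_derivative f (at x) (axis 1 1) = (?s * ?k) *\<^sub>R parallel x"
    "frechet_derivative f (at x) (axis 2 1) = ?s ^ 3 *\<^sub>R meridian x"
    by (simp_all add: frechet_f axis_def)
  then have "unit_normal f x = sgn (wedge3 (?s *\<^sub>R f_vec x) ((?s * ?k) *\<^sub>R parallel x) (?s ^ 3 *\<^sub>R meridian x))"
    by (simp add: unit_normal_def f_eq del: o_apply)
  also have "\<dots> = sgn (c *\<^sub>R n_vec x)"
    by (simp add: wedge3_scaleR wedge3_frame c_def)
  also have "\<dots> = sgn (n_vec x)"
    using \<open>c > 0\<close> by (simp add: sgn_scaleR)
  also have "\<dots> = n_scale (x $ 2) *\<^sub>R n_vec x"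
    by (simp add: sgn_div_norm norm_eq_sqrt_inner inner_n_vec n_scale_def inverse_eq_divide)
  finally show ?thesis .
qed

text \<open>
  Compared with \<open>has_derivative_f\<close>, each of the two partial derivatives of the normal is a multiple of
  the same partial derivative of \<open>f\<close>, with opposite signs: the coordinate lines are lines of
  curvature and the principal curvatures have opposite signs everywhere.
\<close>

lemma has_derivative_unit_normal:
  "(unit_normal f has_derivative
     (\<lambda>a. a $ 1 *\<^sub>R (n_scale (x $ 2) *\<^sub>R parallel x) + a $ 2 *\<^sub>R (- (n_scale (x $ 2) ^ 3) *\<^sub>R meridian x))) (at x)"
proof (rule has_derivative_coordinates)
  fix i :: 4
  let ?m = "n_scale (x $ 2)" and ?k = "w (x $ 2)" and ?k' = "w' (x $ 2)"
  have 2: "((\<lambda>t. n_scale t * (- w t * cos t + w' t * sin t)) has_real_derivative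
      - (?m ^ 3) * (- ?k * ?k' * cos (x $ 2) - (1 + ?k\<^sup>2) * sin (x $ 2))) (at (x $ 2))"
    by (rule derivative_eq_intros DERIV_n_scale DERIV_w DERIV_w' refl)+
      (use arg_cong[OF n_scale_power(2)[of "x $ 2"], of "\<lambda>y. sin (x $ 2) * y"] in \<open>simp add: algebra_simps power2_eq_square\<close>)
  have 3: "((\<lambda>t. n_scale t * (- w t * sin t - w' t * cos t)) has_real_derivative
      - (?m ^ 3) * (- ?k * ?k' * sin (x $ 2) + (1 + ?k\<^sup>2) * cos (x $ 2))) (at (x $ 2))"
    by (rule derivative_eq_intros DERIV_n_scale DERIV_w DERIV_w' refl)+
      (use arg_cong[OF n_scale_power(2)[of "x $ 2"], of "\<lambda>y. cos (x $ 2) * y"] in \<open>simp add: algebra_simps power2_eq_square\<close>)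
  note d = has_derivative_of_coordinate[of _ _ x]
  have 4: "((\<lambda>x. n_scale (x $ 2) * cos (x $ 1)) has_derivative
      (\<lambda>a. a $ 1 * (?m * - sin (x $ 1)) + a $ 2 * (- (?m ^ 3) * (?k' * cos (x $ 1))))) (at x)"
    by (rule has_derivative_eq_rhs, rule has_derivative_mult, rule d[OF DERIV_n_scale], rule d[OF DERIV_cos])
      (auto simp: algebra_simps)
  have 5: "((\<lambda>x. n_scale (x $ 2) * sin (x $ 1)) has_derivative
      (\<lambda>a. a $ 1 * (?m * cos (x $ 1)) + a $ 2 * (- (?m ^ 3) * (?k' * sin (x $ 1))))) (at x)"
    by (rule has_derivative_eq_rhs, rule has_derivative_mult, rule d[OF DERIV_n_scale], rule d[OF DERIV_sin])
      (auto simp: algebra_simps)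
  show "((\<lambda>x. unit_normal f x $ i) has_derivative
      (\<lambda>a. a $ 1 * (?m *\<^sub>R parallel x) $ i + a $ 2 * (- (?m ^ 3) *\<^sub>R meridian x) $ i)) (at x)"
    unfolding unit_normal_f
    using exhaust_4[of i] 4 5 d[OF 2] d[OF 3]
    by (auto simp: n_vec_def parallel_def meridian_def Let_def simp del: o_apply)
qed

lemmas frechet_normal = frechet_derivative_at[OF has_derivative_unit_normal, symmetric]

lemma second_fundamental_form_f:
  "second_fundamental_form f x a b =
     - (n_scale (x $ 2) * f_scale (x $ 2)) * (w (x $ 2) * a $ 1 * b $ 1 - a $ 2 * b $ 2)"
proof -
  let ?s = "f_scale (x $ 2)" and ?k = "w (x $ 2)" and ?m = "n_scale (x $ 2)" and ?k' = "w' (x $ 2)"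
  have "second_fundamental_form f x a b =
      - (?m * ?s * ?k * (a $ 1 * b $ 1)) + (?m ^ 3 * (1 + ?k\<^sup>2 + ?k'\<^sup>2)) * (?s ^ 3 * (1 + ?k\<^sup>2)) * (a $ 2 * b $ 2)"
    by (simp add: second_fundamental_form_def frechet_f frechet_normal inner_add inner_diff
        inner_parallel inner_meridian inner_parallel_meridian inner_commute[of "meridian x" "parallel x"] algebra_simps)
  then show ?thesis
    unfolding f_scale_power n_scale_power by (simp add: algebra_simps)
qed

lemma inj_frechet_f: "inj (frechet_derivative f (at x))"
proof (rule injI)
  fix a b assume *: "frechet_derivative f (at x) a = frechet_derivative f (at x) b"
  let ?D = "frechet_derivative f (at x)"
  have meridian: "meridian x \<bullet> meridian x > 0" by (simp add: inner_meridian add_pos_nonneg)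
  have "?D a \<bullet> parallel x = ?D b \<bullet> parallel x" "?D a \<bullet> meridian x = ?D b \<bullet> meridian x" using * by simp_all
  then show "a = b"
    using f_scale_pos[of "x $ 2"] w_pos[of "x $ 2"] meridian
    by (auto simp: frechet_f inner_add_left inner_parallel inner_parallel_meridian inner_commute[of "meridian x" "parallel x"] vec_eq_iff forall_2)
qed

lemma K_ext_neg: "K_ext f x < 0"
proof -
  let ?s = "f_scale (x $ 2)" and ?k = "w (x $ 2)" and ?m = "n_scale (x $ 2)"
  have pos: "?s > 0" "?k > 0" "?m > 0" using f_scale_pos w_pos n_scale_pos by auto
  have ne: "normal_endomorphism f x v = vector [?m / (?s * ?k) * v $ 1, - (?m ^ 3 / ?s ^ 3) * v $ 2]" (is "_ = ?v") for v
    unfolding normal_endomorphism_def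
  proof (rule the_equality)
    show *: "frechet_derivative f (at x) ?v = frechet_derivative (unit_normal f) (at x) v"
      using pos by (simp add: frechet_f frechet_normal mult.commute)
    show "a = ?v" if "frechet_derivative f (at x) a = frechet_derivative (unit_normal f) (at x) v" for a
      by (rule injD[OF inj_frechet_f[of x]]) (simp only: that *)
  qed
  have "K_ext f x = - (?m / (?s * ?k)) * (?m ^ 3 / ?s ^ 3)"
    by (simp add: K_ext_def det_2 matrix_def ne axis_def)
  then show ?thesis using pos by simp
qed

lemma hyperbolic_region_\<alpha>: "hyperbolic_region \<alpha> = torus"
  using K_ext_neg torus_cover_range by (simp add: hyperbolic_region_def)

lemmas asymptotic_line_fields_f =
  asymptotic_line_fields_diagonal[OF second_fundamental_form_f _ w_pos]

text \<open>
  The length of the image under the derivative of \<open>f\<close> of an asymptotic vector with second coordinate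
  1; it is the same for both families, since the coordinate lines are orthogonal.
\<close>

definition speed where "speed t = sqrt ((f_scale t)\<^sup>2 * w t + f_scale t ^ 4 / (n_scale t)\<^sup>2)"

lemma speed_pos: "speed t > 0"
  using f_scale_pos[of t] n_scale_pos[of t] w_pos[of t] by (simp add: speed_def add_pos_pos)

lemma speed_on_asymptotic_line:
  assumes "v $ 1 = \<sigma> * (1 / sqrt (w (x $ 2))) * v $ 2" "\<sigma>\<^sup>2 = 1"
  shows "norm (frechet_derivative f (at x) v) = speed (x $ 2) * \<bar>v $ 2\<bar>"
proof -
  let ?s = "f_scale (x $ 2)" and ?k = "w (x $ 2)" and ?m = "n_scale (x $ 2)" and ?k' = "w' (x $ 2)"
  have k: "?k > 0" by (rule w_pos)
  have "(v $ 1)\<^sup>2 = (v $ 2)\<^sup>2 / ?k"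
    using k by (simp add: assms power_mult_distrib power_divide)
  then have v1: "?k\<^sup>2 * (v $ 1)\<^sup>2 = ?k * (v $ 2)\<^sup>2"
    using k by (simp add: power2_eq_square)
  have m: "1 + ?k\<^sup>2 + ?k'\<^sup>2 = 1 / ?m\<^sup>2"
    using n_scale_power(1)[of "x $ 2"] n_scale_pos[of "x $ 2"] by (simp add: field_simps)
  have "(norm (frechet_derivative f (at x) v))\<^sup>2
      = ?s\<^sup>2 * (?k\<^sup>2 * (v $ 1)\<^sup>2) + ?s ^ 3 * (?s ^ 3 * (1 + ?k\<^sup>2)) * (1 + ?k\<^sup>2 + ?k'\<^sup>2) * (v $ 2)\<^sup>2"
    unfolding power2_norm_eq_inner
    by (simp add: frechet_f inner_add inner_parallel inner_meridian inner_parallel_meridian inner_commute[of "meridian x" "parallel x"])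
       (simp add: algebra_simps power2_eq_square)
  also have "\<dots> = (speed (x $ 2) * \<bar>v $ 2\<bar>)\<^sup>2"
    unfolding v1 f_scale_power m using f_scale_pos[of "x $ 2"] n_scale_pos[of "x $ 2"] k
    by (simp add: speed_def power_mult_distrib algebra_simps power3_eq_cube power4_eq_xxxx)
  finally show ?thesis
    using speed_pos[of "x $ 2"] by (simp add: power2_eq_iff_nonneg)
qed

text \<open>
  The algebra generated by sines and cosines of the coordinates together with the normalizing
  factor of \<open>f\<close>. It is closed under differentiation because the derivative of that factor is again a
polynomial in the generators.
\<close>

inductive_set trig_algebra :: "(real^2 \<Rightarrow> real) set" where
  const: "(\<lambda>x. c) \<in> trig_algebra"
| sin: "(\<lambda>x. sin (x $ i)) \<in> trig_algebra"
| cos: "(\<lambda>x. cos (x $ i)) \<in> trig_algebra"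
| scale: "(\<lambda>x. f_scale (x $ 2)) \<in> trig_algebra"
| add: "g \<in> trig_algebra \<Longrightarrow> h \<in> trig_algebra \<Longrightarrow> (\<lambda>x. g x + h x) \<in> trig_algebra"
| mult: "g \<in> trig_algebra \<Longrightarrow> h \<in> trig_algebra \<Longrightarrow> (\<lambda>x. g x * h x) \<in> trig_algebra"

lemma trig_algebra_derivative:
  assumes "g \<in> trig_algebra"
  shows "\<exists>g'. (\<forall>x. (g has_derivative g' x) (at x)) \<and> (\<forall>v. (\<lambda>x. g' x v) \<in> trig_algebra)"
  using assms
proof induction
  case (const c)
  show ?case
    by (intro exI[of _ "\<lambda>x v. 0"] conjI allI trig_algebra.const) simp
next
  case (sin i)
  show ?case
    by (intro exI[of _ "\<lambda>x v. v $ i * cos (x $ i)"] conjI allI has_derivative_of_coordinate DERIV_sin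
        trig_algebra.intros)
next
  case (cos i)
  show ?case
    by (intro exI[of _ "\<lambda>x v. v $ i * (- 1 * sin (x $ i))"] conjI allI has_derivative_of_coordinate
        trig_algebra.intros) (simp add: DERIV_cos)
next
  case scale
  have "(f_scale has_real_derivative (1 + e * cos t) * (e * sin t) * (f_scale t * f_scale t * f_scale t)) (at t)" for t
    using DERIV_f_scale[of t] by (simp add: w_def w'_def power3_eq_cube algebra_simps)
  then show ?case
    by (intro exI[of _ "\<lambda>x v. v $ 2 * ((1 + e * cos (x $ 2)) * (e * sin (x $ 2)) * (f_scale (x $ 2) * f_scale (x $ 2) * f_scale (x $ 2)))"] 
        conjI allI has_derivative_of_coordinate trig_algebra.intros)
next
  case (add g h)
  then obtain g' h' where "\<And>x. (g has_derivative g' x) (at x)" "\<And>v. (\<lambda>x. g' x v) \<in> trig_algebra"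
    "\<And>x. (h has_derivative h' x) (at x)" "\<And>v. (\<lambda>x. h' x v) \<in> trig_algebra" by blast
  then show ?case
    by (intro exI[of _ "\<lambda>x v. g' x v + h' x v"] conjI allI has_derivative_add trig_algebra.add)
next
  case (mult g h)
  then obtain g' h' where "\<And>x. (g has_derivative g' x) (at x)" "\<And>v. (\<lambda>x. g' x v) \<in> trig_algebra"
    "\<And>x. (h has_derivative h' x) (at x)" "\<And>v. (\<lambda>x. h' x v) \<in> trig_algebra" by blast
  with mult.hyps show ?case
    by (intro exI[of _ "\<lambda>x v. g x * h' x v + g' x v * h x"] conjI allI has_derivative_mult trig_algebra.intros)
qed

lemma C_k_f: "C_k k f"
proof (rule C_k_if_closed_under_derivatives)
  let ?A = "{F :: real^2 \<Rightarrow> real^4. \<forall>i. (\<lambda>x. F x $ i) \<in> trig_algebra}"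
  have "(\<lambda>x. f x $ i) \<in> trig_algebra" for i
    unfolding f_eq using exhaust_4[of i]
    by (auto simp: f_vec_def w_def intro!: trig_algebra.intros)
  then show "f \<in> ?A" by simp
  fix F assume "F \<in> ?A"
  then have "\<forall>i. \<exists>g'. (\<forall>x. ((\<lambda>x. F x $ i) has_derivative g' x) (at x)) \<and> (\<forall>v. (\<lambda>x. g' x v) \<in> trig_algebra)"
    using trig_algebra_derivative by blast
  then obtain g' where g': "\<And>i x. ((\<lambda>x. F x $ i) has_derivative g' i x) (at x)"
      "\<And>i v. (\<lambda>x. g' i x v) \<in> trig_algebra"
    by metis
  have "(F has_derivative (\<lambda>v. \<chi> i. g' i x v)) (at x)" for x
    using g'(1) by (subst has_derivative_componentwise_within) (auto simp: Basis_vec_def inner_axis)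
  then show "\<exists>F'. (\<forall>x. (F has_derivative F' x) (at x)) \<and> (\<forall>v. (\<lambda>x. F' x v) \<in> ?A)"
    using g'(2) by (intro exI[of _ "\<lambda>x v. \<chi> i. g' i x v"]) simp
qed

text \<open>
  The last two coordinates of the image of \<open>(z, u)\<close> are those of \<open>u\<close> times the normalizing factor; since \<open>u\<close> has
  norm one this determines the factor and \<open>u\<close>, then \<open>r\<close>, and then \<open>z\<close>.
\<close>

lemma inj_on_\<alpha>: "inj_on \<alpha> torus"
proof (rule inj_onI)
  fix p p' assume p: "p \<in> torus" "p' \<in> torus" and eq: "\<alpha> p = \<alpha> p'"
  obtain z u z' u' where zu: "p = (z, u)" "p' = (z', u')" "norm u = 1" "norm u' = 1"
    using p by (auto simp: torus_def)
  define r r' where "r = 1 + e * Re u" and "r' = 1 + e * Re u'"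
  define s s' where "s = 1 / sqrt (1 + r\<^sup>2)" and "s' = 1 / sqrt (1 + r'\<^sup>2)"
  have s: "s > 0" "s' > 0" by (simp_all add: s_def s'_def add_pos_nonneg)
  have "\<alpha> p = s *\<^sub>R vector [r * Re z, r * Im z, Re u, Im u]"
    "\<alpha> p' = s' *\<^sub>R vector [r' * Re z', r' * Im z', Re u', Im u']"
    by (simp_all add: \<alpha>_def zu Let_def r_def r'_def s_def s'_def)
  then have c: "s * (r * Re z) = s' * (r' * Re z')" "s * (r * Im z) = s' * (r' * Im z')"
     "s * Re u = s' * Re u'" "s * Im u = s' * Im u'"
    using eq by (simp_all add: vec_eq_iff forall_4)
  have "s *\<^sub>R u = s' *\<^sub>R u'" using c(3,4) by (simp add: complex_eq_iff)
  then have "norm (s *\<^sub>R u) = norm (s' *\<^sub>R u')" by simp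
  then have ss: "s = s'" using s zu by simp
  then have u: "u = u'" using c(3,4) s by (simp add: complex_eq_iff)
  then have rr: "r = r'" by (simp add: r_def r'_def)
  have "\<bar>e * Re u\<bar> \<le> \<bar>e\<bar>"
    using abs_Re_le_cmod[of u] zu by (simp add: abs_mult mult_left_le)
  then have "r > 0" using e by (simp add: r_def abs_le_iff)
  then have "z = z'" using c(1,2) s ss rr by (simp add: complex_eq_iff)
  then show "p = p'" using u zu by simp
qed

lemma torus_embedding_\<alpha>: "torus_embedding k \<alpha>"
  unfolding torus_embedding_def torus_immersion_def
proof (intro conjI allI C_k_f inj_frechet_f)
  show maps: "\<alpha> \<in> torus \<rightarrow> sphere 0 1"
  proof
    fix p assume "p \<in> torus"
    then obtain x where x: "p = torus_cover x" using torus_cover_range by blast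
    have "(norm (f x))\<^sup>2 = (f_scale (x $ 2))\<^sup>2 * (1 + (w (x $ 2))\<^sup>2)"
      unfolding power2_norm_eq_inner by (simp add: f_eq inner_f_vec power2_eq_square del: o_apply)
    then have "norm (f x) = 1"
      using power2_eq_imp_eq[of "norm (f x)" 1] by (simp add: f_scale_power)
    then show "\<alpha> p \<in> sphere 0 1" by (simp add: x)
  qed
  have "1 + r\<^sup>2 \<noteq> 0" for r :: real
    using add_pos_nonneg[of 1 "r\<^sup>2"] by simp
  then have "continuous_on torus \<alpha>"
    unfolding \<alpha>_def Let_def case_prod_unfold
    by (intro continuous_intros continuous_on_vector_4) auto
  moreover have "compact torus"
    by (simp add: torus_def compact_Times)
  ultimately show "embedding_map (top_of_set torus) (top_of_set (sphere 0 1)) \<alpha>"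
    using maps inj_on_\<alpha>
    by (intro continuous_imp_embedding_map)
       (auto simp: compact_space_subtopology Hausdorff_space_subtopology)
qed

lemma periodic: "w (t + 2 * pi) = w t" "speed (t + 2 * pi) = speed t"
  by (simp_all add: w_def w'_def f_scale_def n_scale_def speed_def)

lemma continuous_w: "continuous_on X w"
  by (simp add: w_def[abs_def] continuous_intros)

lemma continuous_speed: "continuous_on X speed"
proof -
  have [continuous_intros]: "continuous_on X f_scale" "continuous_on X n_scale"
    using DERIV_f_scale DERIV_n_scale by (meson DERIV_isCont continuous_at_imp_continuous_on)+
  have "n_scale t \<noteq> 0" for t using n_scale_pos[of t] by simp
  then show ?thesis
    unfolding speed_def[abs_def] by (intro continuous_intros continuous_w) auto
qed

lemma asymptotic_leaf_dense:
  assumes irrational: "integral {0..2 * pi} (\<lambda>t. 1 / sqrt (w t)) / (2 * pi) \<notin> \<rat>"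
    and L: "\<And>x. L x = {v. v $ 1 = \<sigma> * (1 / sqrt (w (x $ 2))) * v $ 2}" and \<sigma>: "\<sigma> = 1 \<or> \<sigma> = -1"
    and \<gamma>: "\<gamma> \<in> integral_foliation \<alpha> L"
  shows "dense_leaf \<gamma>"
proof -
  obtain I c where c: "\<gamma> = (I, torus_cover \<circ> c)" "maximal_integral_curve \<alpha> L I c"
    using \<gamma> by (auto simp: integral_foliation_def)
  have "dense_leaf (I, torus_cover \<circ> c)"
  proof (rule maximal_integral_curve_dense[where g = "\<lambda>t. \<sigma> * (1 / sqrt (w t))" and q = speed, OF _ _ _ _ _ _ _ _ _ c(2)])
    show "norm (frechet_derivative f (at x) v) = speed (x $ 2) * \<bar>v $ 2\<bar>" if "v \<in> L x" for x v
      using that \<sigma> by (intro speed_on_asymptotic_line[of v \<sigma>]) (auto simp: L)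
    have "w t \<noteq> 0" for t using w_pos[of t] by simp
    then show "continuous_on UNIV (\<lambda>t. \<sigma> * (1 / sqrt (w t)))"
      by (intro continuous_intros continuous_w) auto
    show "integral {0..2 * pi} (\<lambda>t. \<sigma> * (1 / sqrt (w t))) / (2 * pi) \<notin> \<rat>"
      using irrational \<sigma> by (auto simp del: times_divide_eq_right)
  qed (simp_all add: L periodic continuous_speed speed_pos hyperbolic_region_\<alpha>)
  then show ?thesis by (simp add: c)
qed

lemma asymptotic_foliations_dense:
  assumes "integral {0..2 * pi} (\<lambda>t. 1 / sqrt (w t)) / (2 * pi) \<notin> \<rat>"
  shows "\<forall>\<gamma> \<in> asymptotic_foliation1 \<alpha>. dense_leaf \<gamma>" "\<forall>\<gamma> \<in> asymptotic_foliation2 \<alpha>. dense_leaf \<gamma>"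
proof -
  have neg: "- (n_scale (x $ 2) * f_scale (x $ 2)) < 0" for x :: "real^2"
    using n_scale_pos[of "x $ 2"] f_scale_pos[of "x $ 2"] by simp
  note L = asymptotic_line_fields_f[OF neg]
  show "\<forall>\<gamma> \<in> asymptotic_foliation1 \<alpha>. dense_leaf \<gamma>"
    unfolding asymptotic_foliation1_def
    using asymptotic_leaf_dense[OF assms, of "asymptotic_line_field1 f" 1] L(1) by simp
  show "\<forall>\<gamma> \<in> asymptotic_foliation2 \<alpha>. dense_leaf \<gamma>"
    unfolding asymptotic_foliation2_def
    using asymptotic_leaf_dense[OF assms, of "asymptotic_line_field2 f" "-1"] L(2) by simp
qed

end

section \<open>The rotation number\<close>

text \<open>
  Strict convexity of \<open>1 / sqrt y\<close>, by comparison with its tangent at 1.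
\<close>

lemma inverse_sqrt_above_tangent:
  fixes y :: real
  assumes "y > 0"
  shows "(3 - y) / 2 \<le> 1 / sqrt y" "y \<noteq> 1 \<Longrightarrow> (3 - y) / 2 < 1 / sqrt y"
proof -
  define s where "s = sqrt y"
  have s: "s > 0" "y = s\<^sup>2" using assms by (auto simp: s_def)
  have *: "1 / sqrt y - (3 - y) / 2 = (s - 1)\<^sup>2 * (s + 2) / (2 * s)"
    using s by (simp add: field_simps power2_eq_square)
  have "(s - 1)\<^sup>2 * (s + 2) / (2 * s) \<ge> 0" using s by simp
  with * show "(3 - y) / 2 \<le> 1 / sqrt y" by linarith
  assume "y \<noteq> 1"
  then have "s \<noteq> 1" using s by auto
  then have "(s - 1)\<^sup>2 * (s + 2) / (2 * s) > 0" using s by simp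
  with * show "(3 - y) / 2 < 1 / sqrt y" by linarith
qed

text \<open>
  The tangent inequality compares \<open>1 / sqrt (1 + cos t / 2)\<close> with \<open>1 - cos t / 4\<close>, whose mean is 1, so the
  rotation number at 1/2 exceeds its value 1 at 0. Between two distinct reals there is an irrational
  one, and it is attained by continuity.
\<close>

lemma exists_irrational_rotation_number:
  obtains e :: real where "\<bar>e\<bar> < 1" "integral {0..2 * pi} (\<lambda>t. 1 / sqrt (1 + e * cos t)) / (2 * pi) \<notin> \<rat>"
proof -
  have pos: "1 + e * cos t > 0" if "e \<in> {0..1/2}" for e t :: real
  proof -
    have "\<bar>e * cos t\<bar> \<le> (1/2) * 1"
      unfolding abs_mult using that by (intro mult_mono) auto
    then show ?thesis by (simp add: abs_le_iff)
  qed
  define \<rho> where "\<rho> = (\<lambda>e. integral {0..2 * pi} (\<lambda>t. 1 / sqrt (1 + e * cos t)) / (2 * pi))"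
  have "continuous_on ({0..1/2} \<times> cbox 0 (2 * pi)) (\<lambda>(e, t). 1 / sqrt (1 + e * cos t))"
    unfolding case_prod_unfold using pos by (intro continuous_intros) (force simp: less_imp_neq[symmetric])+
  from integral_continuous_on_param[OF this] have cont: "continuous_on {0..1/2} \<rho>"
    unfolding \<rho>_def by (intro continuous_intros) auto
  define h where "h = (\<lambda>t::real. 1 / sqrt (1 + 1/2 * cos t) - (1 - cos t / 4))"
  have cont_h: "continuous_on {0..2 * pi} (\<lambda>t. 1 / sqrt (1 + 1/2 * cos t))"
    using pos[of "1/2"] by (intro continuous_intros) (force simp: less_imp_neq[symmetric])
  have h_int: "integral {0..2 * pi} h = 2 * pi * \<rho> (1/2) - 2 * pi"
  proof -
    have "((\<lambda>t. 1 - cos t / 4) has_integral (2 * pi - sin (2 * pi) / 4) - (0 - sin 0 / 4)) {0..2 * pi}"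
      by (rule fundamental_theorem_of_calculus)
        (auto intro!: derivative_eq_intros simp: has_real_derivative_iff_has_vector_derivative[symmetric])
    then have "((\<lambda>t. 1 - cos t / 4) has_integral 2 * pi) {0..2 * pi}" by simp
    from has_integral_diff[OF integrable_integral[OF integrable_continuous_real[OF cont_h]] this]
    show ?thesis by (simp add: h_def \<rho>_def integral_unique)
  qed
  have h_nonneg: "h t \<ge> 0" for t
    using inverse_sqrt_above_tangent(1)[OF pos[of "1/2" t]] by (simp add: h_def field_simps)
  have "h 0 \<noteq> 0"
    using inverse_sqrt_above_tangent(2)[of "3/2"] by (simp add: h_def)
  moreover have "continuous_on {0..2 * pi} h"
    unfolding h_def by (rule continuous_on_diff[OF cont_h]) (auto intro!: continuous_intros)
  ultimately have "integral {0..2 * pi} h \<noteq> 0"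
    using integral_eq_0_iff[of 0 "2 * pi" h] h_nonneg by auto
  moreover have "integral {0..2 * pi} h \<ge> 0"
    using h_nonneg by (intro Henstock_Kurzweil_Integration.integral_nonneg integrable_continuous_real \<open>continuous_on _ h\<close>)
  ultimately have "2 * pi * 1 < 2 * pi * \<rho> (1/2)" by (simp add: h_int)
  then have "1 < \<rho> (1/2)" by simp
  then obtain y where y: "y \<in> {1<..<\<rho> (1/2)}" "y \<notin> \<rat>"
    using uncountable_open_interval[of 1 "\<rho> (1/2)"] countable_subset[OF _ countable_rat] by blast
  have "\<rho> 0 = 1" by (simp add: \<rho>_def)
  then obtain e where "e \<in> {0..1/2}" "\<rho> e = y"
    using IVT'[of \<rho> 0 y "1/2"] cont y(1) by auto
  then show thesis
    using that[of e] y(2) by (auto simp: \<rho>_def)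
qed

theorem theorem1:
  fixes r :: nat
  assumes "r \<ge> 3"
  shows "\<exists>\<alpha> :: complex \<times> complex \<Rightarrow> real^4. torus_embedding r \<alpha> \<and>
           (\<forall>\<gamma> \<in> asymptotic_foliation1 \<alpha>. dense_leaf \<gamma>) \<and>
           (\<forall>\<gamma> \<in> asymptotic_foliation2 \<alpha>. dense_leaf \<gamma>)"
proof -
  obtain e :: real where e: "\<bar>e\<bar> < 1"
    and irrational: "integral {0..2 * pi} (\<lambda>t. 1 / sqrt (1 + e * cos t)) / (2 * pi) \<notin> \<rat>"
    by (rule exists_irrational_rotation_number)
  interpret rotation_torus e by standard (rule e)
  show ?thesis
    using torus_embedding_\<alpha> asymptotic_foliations_dense irrational unfolding w_def by blast
qed

end
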